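(* Suppose that $G$ is a finite nilpotent group and that $P^*(G)$ is claw-free. Then either $G$ is a $p$-group for some prime $p$, or $G$ is cyclic and $|G|=p^nq$, where $n\in\mathbb{N}$ and $p,q$ are distinct primes.
   Context: For a group $G$, the power graph $P(G)$ is the simple undirected graph whose vertices are the elements of $G$, two distinct vertices $u,v$ being adjacent if and only if one of them is a power of the other (equivalently, one of $\langle u\rangle,\langle v\rangle$ is contained in the other). The reduced power graph $P^*(G)$ is the subgraph of $P(G)$ induced by the non-identity elements. A graph is claw-free if it has no induced subgraph isomorphic to the complete bipartite graph $K_{1,3}$. *)

theory Defs
  imports "HOL-Algebra.Algebra" "Graph_Theory.Graph_Theory"
begin

section \<open>Nilpotent groups and p-groups\<close>

definition commutator_with :: "('a, 'b) monoid_scheme \<Rightarrow> 'a set \<Rightarrow> 'a set" where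
  "commutator_with G H = generate G
     (\<Union>h\<in>H. \<Union>g\<in>carrier G. {h \<otimes>\<^bsub>G\<^esub> g \<otimes>\<^bsub>G\<^esub> inv\<^bsub>G\<^esub> h \<otimes>\<^bsub>G\<^esub> inv\<^bsub>G\<^esub> g})"

text \<open>The lower central series, indexed from \<open>0\<close>: its term \<open>0\<close> is \<open>G\<close> and its term \<open>Suc n\<close> is
  the commutator subgroup \<open>[L, G]\<close>, where \<open>L\<close> is term \<open>n\<close>.\<close>

definition lower_central :: "('a, 'b) monoid_scheme \<Rightarrow> nat \<Rightarrow> 'a set" where
  "lower_central G n = (commutator_with G ^^ n) (carrier G)"

definition nilpotent_group :: "('a, 'b) monoid_scheme \<Rightarrow> bool" where
  "nilpotent_group G \<longleftrightarrow> group G \<and> (\<exists>n. lower_central G n = {\<one>\<^bsub>G\<^esub>})"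

text \<open>Finite \<open>p\<close>-groups only; the trivial group is a \<open>p\<close>-group for every prime \<open>p\<close>.\<close>

definition finite_p_group :: "nat \<Rightarrow> ('a, 'b) monoid_scheme \<Rightarrow> bool" where
  "finite_p_group p G \<longleftrightarrow> Factorial_Ring.prime p \<and> group G \<and> finite (carrier G) \<and> (\<exists>k. order G = p ^ k)"


section \<open>Power graphs\<close>

text \<open>A simple undirected graph is represented, as in \<^locale>\<open>graph\<close>, by a loop-free symmetric
  digraph without parallel arcs: each edge is a pair of opposite arcs.\<close>

definition power_adj :: "('a, 'b) monoid_scheme \<Rightarrow> 'a \<Rightarrow> 'a \<Rightarrow> bool" where
  "power_adj G u v \<longleftrightarrow> u \<noteq> v \<and>
     ((\<exists>k::int. u = v [^]\<^bsub>G\<^esub> k) \<or> (\<exists>k::int. v = u [^]\<^bsub>G\<^esub> k))"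

definition power_graph :: "('a, 'b) monoid_scheme \<Rightarrow> ('a, 'a \<times> 'a) pre_digraph" where
  "power_graph G = with_proj
     \<lparr> pverts = carrier G,
       parcs = {(u, v). u \<in> carrier G \<and> v \<in> carrier G \<and> power_adj G u v} \<rparr>"

definition reduced_power_graph :: "('a, 'b) monoid_scheme \<Rightarrow> ('a, 'a \<times> 'a) pre_digraph" where
  "reduced_power_graph G = power_graph G \<restriction> (carrier G - {\<one>\<^bsub>G\<^esub>})"

text \<open>The predicate \<^const>\<open>complete_bipartite_digraph\<close> holds of every graph isomorphic to the
  complete bipartite graph with parts of the given sizes.\<close>

definition claw_free :: "('a, 'b) pre_digraph \<Rightarrow> bool" where
  "claw_free \<Gamma> \<longleftrightarrow> \<not> (\<exists>H. induced_subgraph H \<Gamma> \<and> complete_bipartite_digraph 1 3 H)"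

lemma graph_with_proj_power_adj:
  assumes "finite A"
  shows "graph (with_proj \<lparr> pverts = A, parcs = {(u, v). u \<in> A \<and> v \<in> A \<and> power_adj G u v} \<rparr>)"
proof -
  let ?E = "{(u, v). u \<in> A \<and> v \<in> A \<and> power_adj G u v}"
  have "?E \<subseteq> A \<times> A" by auto
  then have fin: "finite ?E" using assms finite_subset by blast
  interpret pair_graph "\<lparr> pverts = A, parcs = ?E \<rparr>"
  proof unfold_locales
    show "symmetric (with_proj \<lparr> pverts = A, parcs = ?E \<rparr>)"
      by (auto simp: symmetric_def arcs_ends_def arc_to_ends_def power_adj_def intro!: symI)
  qed (use assms fin in \<open>auto simp: power_adj_def\<close>)
  show ?thesis by unfold_locales
qed

lemma reduced_power_graph_eq:
  "reduced_power_graph G = with_proj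
     \<lparr> pverts = carrier G - {\<one>\<^bsub>G\<^esub>},
       parcs = {(u, v). u \<in> carrier G - {\<one>\<^bsub>G\<^esub>} \<and> v \<in> carrier G - {\<one>\<^bsub>G\<^esub>} \<and> power_adj G u v} \<rparr>"
  by (auto simp: reduced_power_graph_def power_graph_def induce_subgraph_def with_proj_def)

lemma graph_power_graph: "finite (carrier G) \<Longrightarrow> graph (power_graph G)"
  unfolding power_graph_def by (rule graph_with_proj_power_adj)

lemma graph_reduced_power_graph: "finite (carrier G) \<Longrightarrow> graph (reduced_power_graph G)"
  unfolding reduced_power_graph_eq by (rule graph_with_proj_power_adj) simp

end

theory Submission
  imports Defs
begin

text \<open>
  A claw in the reduced power graph is most easily found from three elements no two of which are
  powers of one another, together with a fourth element that either has all three as powers or is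
  a power of all three. Every claw below arises in this way (\<open>not_claw_freeI\<close>), and nilpotency is
  used only through the fact that elements of coprime orders commute
  (\<open>nilpotent_coprime_commute\<close>).

  Suppose that the order of \<open>G\<close> is not a prime power.

  If three primes divide it, choose commuting elements \<open>x\<close>, \<open>y\<close>, \<open>z\<close> of those prime orders: the
  product \<open>xyz\<close> has each of them as a power, and they form a claw with centre \<open>xyz\<close>. So the order
  is \<open>p\<^sup>a q\<^sup>b\<close> with \<open>a, b \<ge> 1\<close>.

  The Sylow subgroups are cyclic. Indeed, a non-cyclic group is not a union of two proper
  subgroups, and therefore has at least three maximal cyclic subgroups; generators of these, for a
  non-cyclic Sylow \<open>p\<close>-subgroup, are three elements of which none is a power of another
  (\<open>noncyclic_subgroup_antichain\<close>). Multiplying each of them by one element \<open>y\<close> of order \<open>q\<close> keeps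
  them incomparable and makes \<open>y\<close> a power of each, which is a claw with centre \<open>y\<close>. Hence \<open>G\<close> is
  generated by \<open>xy\<close>, where \<open>x\<close> and \<open>y\<close> generate a Sylow \<open>p\<close>-subgroup and a Sylow \<open>q\<close>-subgroup.

  Finally, if \<open>a, b \<ge> 2\<close>, then \<open>x\<close>, \<open>y\<close> and \<open>x\<^sup>p y\<^sup>q\<close> are incomparable powers of \<open>xy\<close>: in the
  divisor lattice of \<open>p\<^sup>a q\<^sup>b\<close> their orders \<open>p\<^sup>a\<close>, \<open>q\<^sup>b\<close> and \<open>p\<^bsup>a-1\<^esup> q\<^bsup>b-1\<^esup>\<close> form an antichain.
  This is one more claw, so one of the two exponents is \<open>1\<close>.
\<close>

section \<open>Claws from antichains of cyclic subgroups\<close>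

definition power_antichain :: "('a, 'b) monoid_scheme \<Rightarrow> 'a set \<Rightarrow> bool" where
  "power_antichain G L \<longleftrightarrow> pairwise (\<lambda>u v. u \<notin> generate G {v}) L"

lemma power_antichain_triple:
  assumes "x \<notin> generate G {y}" "x \<notin> generate G {z}" "y \<notin> generate G {x}"
    "y \<notin> generate G {z}" "z \<notin> generate G {x}" "z \<notin> generate G {y}"
  shows "card {x, y, z} = 3" "power_antichain G {x, y, z}"
proof -
  have "u \<in> generate G {u}" for u by (simp add: generate.incl)
  with assms have "x \<noteq> y" "x \<noteq> z" "y \<noteq> z" by metis+
  then show "card {x, y, z} = 3" by simp
  show "power_antichain G {x, y, z}" using assms by (auto simp: power_antichain_def pairwise_insert)
qed

text \<open>Three incomparable elements are never adjacent, and a common upper or lower bound \<open>c\<close> of their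
  cyclic subgroups is adjacent to all of them. It is not itself a leaf, since two leaves would then
  be comparable, and the identity is not a leaf, being a power of every other element. For that
  reason the identity would also be a lower bound of any three leaves, so \<open>c \<noteq> \<one>\<close> is required.\<close>

lemma not_claw_freeI:
  assumes "group G" "finite (carrier G)"
    and c: "c \<in> carrier G" "c \<noteq> \<one>\<^bsub>G\<^esub>"
    and L: "L \<subseteq> carrier G" "card L = 3"
    and "power_antichain G L"
    and centre: "(\<forall>u\<in>L. u \<in> generate G {c}) \<or> (\<forall>u\<in>L. c \<in> generate G {u})"
  shows "\<not> claw_free (reduced_power_graph G)"
proof -
  interpret group G by fact
  let ?\<Gamma> = "reduced_power_graph G"
  have gen: "u \<in> generate G {v} \<longleftrightarrow> (\<exists>k::int. u = v [^]\<^bsub>G\<^esub> k)" if "v \<in> carrier G" for u v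
    using generate_pow[OF that] by auto
  have anti: "u \<notin> generate G {v}" if "u \<in> L" "v \<in> L" "u \<noteq> v" for u v
    using \<open>power_antichain G L\<close> that by (simp add: power_antichain_def pairwise_def)
  have other: "\<exists>v\<in>L. v \<noteq> u" for u
  proof (rule ccontr)
    assume "\<not> ?thesis"
    then have "L \<subseteq> {u}" by blast
    then have "card L \<le> card {u}" by (intro card_mono) auto
    with L show False by simp
  qed
  have one: "\<one>\<^bsub>G\<^esub> \<notin> L"
    using other[of "\<one>\<^bsub>G\<^esub>"] anti generate.one by metis
  have cL: "c \<notin> L"
    using other[of c] anti centre by metis
  have fin: "finite L" using L(2) by (metis card.infinite zero_neq_numeral)
  have star: "power_adj G c u \<and> power_adj G u c" if "u \<in> L" for u
  proof -
    have "u \<in> carrier G" using that L by blast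
    moreover have "u \<noteq> c" using that cL by blast
    moreover have "u \<in> generate G {c} \<or> c \<in> generate G {u}" using that centre by blast
    ultimately show ?thesis using c(1) by (auto simp: power_adj_def gen)
  qed
  have indep: "\<not> power_adj G u v" if "u \<in> L" "v \<in> L" for u v
  proof
    assume adj: "power_adj G u v"
    have "u \<in> carrier G" "v \<in> carrier G" using that L by blast+
    with adj have "u \<noteq> v" "u \<in> generate G {v} \<or> v \<in> generate G {u}"
      by (auto simp: power_adj_def gen)
    with anti that show False by blast
  qed
  have refl: "\<not> power_adj G c c" by (simp add: power_adj_def)
  let ?V = "insert c L"
  let ?H = "with_proj \<lparr> pverts = ?V, parcs = {c} \<times> L \<union> L \<times> {c} \<rparr>"
  have V: "?V \<subseteq> carrier G - {\<one>\<^bsub>G\<^esub>}" using c L one by auto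
  have H: "K\<^bsub>1,3\<^esub> ?H"
    unfolding complete_bipartite_digraph_pair_def
    using fin L(2) cL by (intro conjI exI[of _ "{c}"] exI[of _ L]) auto
  have arcs: "arcs ?H = {e \<in> arcs ?\<Gamma>. tail ?\<Gamma> e \<in> verts ?H \<and> head ?\<Gamma> e \<in> verts ?H}"
  proof -
    have restrict: "{(u, v). u \<in> A \<and> v \<in> A \<and> P u v}
        = {e. (case e of (u, v) \<Rightarrow> u \<in> B \<and> v \<in> B \<and> P u v) \<and> fst e \<in> A \<and> snd e \<in> A}"
      if "A \<subseteq> B" for A B :: "'a set" and P
      using that by auto
    have "{c} \<times> L \<union> L \<times> {c} = {(u, v). u \<in> ?V \<and> v \<in> ?V \<and> power_adj G u v}"
      using star indep refl by blast
    also have "\<dots> = {e \<in> arcs ?\<Gamma>. tail ?\<Gamma> e \<in> verts ?H \<and> head ?\<Gamma> e \<in> verts ?H}"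
      using restrict[OF V, of "power_adj G"] by (simp add: reduced_power_graph_eq)
    finally show ?thesis by simp
  qed
  have "graph ?\<Gamma>" by (rule graph_reduced_power_graph) fact
  then interpret \<Gamma>: graph ?\<Gamma> .
  have "graph ?H" using H by (simp add: complete_bipartite_digraph_def)
  then interpret H: graph ?H .
  have "subgraph ?H ?\<Gamma>"
    unfolding subgraph_def
  proof (intro conjI)
    show "verts ?H \<subseteq> verts ?\<Gamma>" unfolding reduced_power_graph_eq using V by auto
    show "arcs ?H \<subseteq> arcs ?\<Gamma>" using arcs by blast
    show "wf_digraph ?\<Gamma>" "wf_digraph ?H" by unfold_locales
    show "compatible ?\<Gamma> ?H" by (simp add: compatible_def reduced_power_graph_eq)
  qed
  with arcs have "induced_subgraph ?H ?\<Gamma>" by (simp add: induced_subgraph_def)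
  with H show ?thesis unfolding claw_free_def by blast
qed

section \<open>Products of commuting elements of coprime orders\<close>

text \<open>By Bezout there is an \<open>e\<close> with \<open>e \<equiv> 1\<close> modulo \<open>m\<close> and \<open>e \<equiv> 0\<close> modulo \<open>n\<close>. It matters that
  \<open>e\<close> depends on \<open>m\<close> and \<open>n\<close> only: raising to the power \<open>e\<close> strips the factor \<open>y\<close> from several
  products at once, and so transports a relation \<open>u y = (v y)\<^sup>k\<close> to \<open>u = v\<^sup>k\<close>.\<close>

lemma (in group) coprime_product_powers:
  fixes m n :: nat
  assumes "coprime m n"
  shows "\<exists>e::int. \<forall>x y.  x \<in> carrier G \<longrightarrow> y \<in> carrier G \<longrightarrow> x \<otimes> y = y \<otimes> x \<longrightarrow>
    x [^] m = \<one> \<longrightarrow> y [^] n = \<one> \<longrightarrow> (x \<otimes> y) [^] e = x"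
proof -
  obtain u v :: int where uv: "u * int m + v * int n = 1"
    using assms bezout_int[of "int m" "int n"] by (auto simp: coprime_iff_gcd_eq_1)
  have "(x \<otimes> y) [^] (v * int n) = x"
    if xy: "x \<in> carrier G" "y \<in> carrier G" "x \<otimes> y = y \<otimes> x" "x [^] m = \<one>" "y [^] n = \<one>" for x y
  proof -
    have "x [^] (int m * u) = \<one>" "y [^] (int n * v) = \<one>"
      using xy by (metis int_pow_int int_pow_pow int_pow_one)+
    moreover have "x = x [^] (int m * u) \<otimes> x [^] (int n * v)"
      using uv xy by (metis int_pow_1 int_pow_mult mult.commute)
    ultimately have "x [^] (v * int n) = x" "y [^] (v * int n) = \<one>"
      using xy by (metis int_pow_closed l_one mult.commute)+
    then show ?thesis using xy by (simp add: int_pow_mult_distrib)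
  qed
  then show ?thesis by blast
qed

lemma (in group) coprime_factor_in_generate:
  fixes m n :: nat
  assumes "coprime m n" "x \<in> carrier G" "y \<in> carrier G" "x \<otimes> y = y \<otimes> x"
    "x [^] m = \<one>" "y [^] n = \<one>"
  shows "x \<in> generate G {x \<otimes> y}" "y \<in> generate G {x \<otimes> y}"
proof -
  have *: "a \<in> generate G {a \<otimes> b}"
    if ab: "coprime k l" "a \<in> carrier G" "b \<in> carrier G" "a \<otimes> b = b \<otimes> a" "a [^] k = \<one>" "b [^] l = \<one>"
    for a b and k l :: nat
  proof -
    obtain e :: int where "(a \<otimes> b) [^] e = a"
      using coprime_product_powers[OF ab(1)] ab by metis
    then have "a = (a \<otimes> b) [^] e" by simp
    then show ?thesis using ab generate_pow[of "a \<otimes> b"] by blast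
  qed
  show "x \<in> generate G {x \<otimes> y}" using *[of m n x y] assms by simp
  show "y \<in> generate G {x \<otimes> y}" using *[of n m y x] assms by (simp add: coprime_commute)
qed

lemma (in group) generate_singleton_trans:
  assumes "u \<in> generate G {v}" "v \<in> generate G {w}" "w \<in> carrier G"
  shows "u \<in> generate G {w}"
proof -
  have "subgroup (generate G {w}) G" using assms(3) by (intro generate_is_subgroup) simp
  then have "generate G {v} \<subseteq> generate G {w}"
    using assms(2) by (intro generate_subgroup_incl) simp_all
  then show ?thesis using assms(1) by blast
qed

lemma (in group) pow_eq_one_of_generate:
  assumes "u \<in> generate G {v}" "v \<in> carrier G" "v [^] (k::nat) = \<one>"
  shows "u [^] k = \<one>"
proof -
  obtain j :: int where "u = v [^] j" using assms generate_pow by auto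
  then have "u [^] k = v [^] (int k * j)"
    using assms by (metis int_pow_int int_pow_pow mult.commute)
  also have "\<dots> = (v [^] k) [^] j" using assms(2) by (metis int_pow_int int_pow_pow)
  finally show ?thesis using assms(3) by simp
qed

lemma (in group) eq_one_of_coprime_pow:
  fixes m n :: nat
  assumes "u \<in> carrier G" "u [^] m = \<one>" "u [^] n = \<one>" "coprime m n"
  shows "u = \<one>"
proof -
  have "ord u dvd m" "ord u dvd n" using assms pow_eq_id by auto
  then have "ord u = 1" using \<open>coprime m n\<close> coprime_common_divisor_nat by blast
  then show ?thesis using assms ord_eq_1 by blast
qed

section \<open>Coprime elements of a nilpotent group commute\<close>

text \<open>If the commutator \<open>z\<close> of \<open>a\<close> and \<open>b\<close> commutes with both, then \<open>[a\<^sup>k, b] = z\<^sup>k = [a, b\<^sup>k]\<close>. So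
  both exponents \<open>m\<close> and \<open>n\<close> kill \<open>z\<close>.\<close>

lemma (in group) central_commutator_eq_one:
  fixes m n :: nat
  assumes car: "a \<in> carrier G" "b \<in> carrier G" "z \<in> carrier G"
    and ab: "a \<otimes> b = z \<otimes> (b \<otimes> a)" and za: "z \<otimes> a = a \<otimes> z" and zb: "z \<otimes> b = b \<otimes> z"
    and "a [^] m = \<one>" "b [^] n = \<one>" "coprime m n"
  shows "z = \<one>"
proof -
  have 1: "a [^] k \<otimes> b = z [^] k \<otimes> (b \<otimes> a [^] k)" for k :: nat
  proof (induction k)
    case (Suc k)
    have "a [^] Suc k \<otimes> b = a [^] k \<otimes> (a \<otimes> b)" using car by (simp add: m_assoc)
    also have "\<dots> = (a [^] k \<otimes> z) \<otimes> b \<otimes> a" using car ab by (simp add: m_assoc)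
    also have "a [^] k \<otimes> z = z \<otimes> a [^] k" using car za by (metis group_commutes_pow)
    also have "z \<otimes> a [^] k \<otimes> b \<otimes> a = z \<otimes> (a [^] k \<otimes> b) \<otimes> a" using car by (simp add: m_assoc)
    also have "\<dots> = (z \<otimes> z [^] k) \<otimes> (b \<otimes> (a [^] k \<otimes> a))" using car Suc by (simp add: m_assoc)
    also have "z \<otimes> z [^] k = z [^] Suc k" using car by (metis nat_pow_Suc2)
    finally show ?case by simp
  qed (use car in simp)
  have 2: "a \<otimes> b [^] k = z [^] k \<otimes> (b [^] k \<otimes> a)" for k :: nat
  proof (induction k)
    case (Suc k)
    have "a \<otimes> b [^] Suc k = (a \<otimes> b [^] k) \<otimes> b" using car by (simp add: m_assoc)
    also have "\<dots> = z [^] k \<otimes> b [^] k \<otimes> (a \<otimes> b)" using car Suc by (simp add: m_assoc)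
    also have "\<dots> = z [^] k \<otimes> (b [^] k \<otimes> z) \<otimes> (b \<otimes> a)" using car ab by (simp add: m_assoc)
    also have "b [^] k \<otimes> z = z \<otimes> b [^] k" using car zb by (metis group_commutes_pow)
    finally show ?case using car by (simp add: m_assoc)
  qed (use car in simp)
  have "z [^] m = \<one>" using 1[of m] car assms by simp
  moreover have "z [^] n = \<one>" using 2[of n] car assms by simp
  ultimately show ?thesis using eq_one_of_coprime_pow car \<open>coprime m n\<close> by blast
qed

lemma (in group) commutator_with_normal:
  assumes "H \<lhd> G"
  shows "commutator_with G H \<lhd> G"
  unfolding commutator_with_def
proof (rule normal_generateI)
  have H: "H \<subseteq> carrier G" using assms normal_imp_subgroup subgroup.subset by blast
  then show "(\<Union>h\<in>H. \<Union>g\<in>carrier G. {h \<otimes> g \<otimes> inv h \<otimes> inv g}) \<subseteq> carrier G" by auto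
  fix c x assume "c \<in> (\<Union>h\<in>H. \<Union>g\<in>carrier G. {h \<otimes> g \<otimes> inv h \<otimes> inv g})" and x: "x \<in> carrier G"
  then obtain h g where hg: "h \<in> H" "g \<in> carrier G" and c: "c = h \<otimes> g \<otimes> inv h \<otimes> inv g" by auto
  have h: "h \<in> carrier G" using hg H by auto
  let ?h = "x \<otimes> h \<otimes> inv x" and ?g = "x \<otimes> g \<otimes> inv x"
  have "?h \<in> H" by (rule normal.inv_op_closed2[OF assms x hg(1)])
  moreover have "?g \<in> carrier G" using x hg by auto
  moreover have cancel: "inv x \<otimes> (x \<otimes> a) = a" if "a \<in> carrier G" for a
    using x that by (simp flip: m_assoc)
  moreover have "x \<otimes> c \<otimes> inv x = ?h \<otimes> ?g \<otimes> inv ?h \<otimes> inv ?g"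
    using x h hg cancel by (simp add: c m_assoc inv_mult_group)
  ultimately show "x \<otimes> c \<otimes> inv x \<in> (\<Union>h\<in>H. \<Union>g\<in>carrier G. {h \<otimes> g \<otimes> inv h \<otimes> inv g})" by blast
qed

lemma (in group) lower_central_normal: "lower_central G k \<lhd> G"
proof (induction k)
  case 0
  show ?case by (simp add: lower_central_def normal_self)
qed (simp add: lower_central_def commutator_with_normal)

lemma (in group) commutator_split:
  assumes "x \<in> carrier G" "y \<in> carrier G"
  shows "x \<otimes> y = (x \<otimes> y \<otimes> inv x \<otimes> inv y) \<otimes> (y \<otimes> x)"
proof -
  have "inv a \<otimes> (a \<otimes> b) = b" if "a \<in> carrier G" "b \<in> carrier G" for a b
    using that by (simp flip: m_assoc)
  then show ?thesis using assms by (simp add: m_assoc)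
qed

text \<open>Descending the lower central series: if \<open>[x, y]\<close> lies in term \<open>k\<close>, then its image in the
  quotient by term \<open>k + 1\<close> is central, hence trivial by the previous argument, so \<open>[x, y]\<close> lies
  in term \<open>k + 1\<close>.\<close>

lemma (in group) coprime_commutator_in_lower_central:
  fixes m n :: nat
  assumes xy: "x \<in> carrier G" "y \<in> carrier G" and pow: "x [^] m = \<one>" "y [^] n = \<one>"
    and "coprime m n"
  shows "x \<otimes> y \<otimes> inv x \<otimes> inv y \<in> lower_central G k"
proof (induction k)
  case 0
  show ?case using xy by (simp add: lower_central_def)
next
  case (Suc k)
  let ?c = "x \<otimes> y \<otimes> inv x \<otimes> inv y" and ?N = "lower_central G (Suc k)"
  let ?f = "\<lambda>g. ?N #> g"
  interpret N: normal ?N G by (rule lower_central_normal)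
  interpret f: group_hom G "G Mod ?N" ?f
    using N.factorgroup_is_group N.r_coset_hom_Mod group_axioms
    by (simp add: group_hom_def group_hom_axioms_def)
  have c: "?c \<in> carrier G" using xy by simp
  have ker: "?f g = \<one>\<^bsub>G Mod ?N\<^esub> \<longleftrightarrow> g \<in> ?N" if "g \<in> carrier G" for g
    using coset_join1[OF _ that N.subgroup_axioms] coset_join2[OF that N.subgroup_axioms] by auto
  have central: "?f ?c \<otimes>\<^bsub>G Mod ?N\<^esub> ?f g = ?f g \<otimes>\<^bsub>G Mod ?N\<^esub> ?f ?c" if g: "g \<in> carrier G" for g
  proof -
    have "?c \<otimes> g \<otimes> inv ?c \<otimes> inv g \<in> ?N"
      using Suc g unfolding lower_central_def by (auto simp: commutator_with_def intro: generate.incl)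
    moreover have "?c \<otimes> g = (?c \<otimes> g \<otimes> inv ?c \<otimes> inv g) \<otimes> (g \<otimes> ?c)"
      by (rule commutator_split) (use c g in auto)
    ultimately have "?f (?c \<otimes> g) = ?f (g \<otimes> ?c)"
      using c g ker by (metis f.hom_mult f.H.l_one f.hom_closed inv_closed m_closed)
    then show ?thesis using c g by simp
  qed
  have "x \<otimes> y = ?c \<otimes> (y \<otimes> x)" by (rule commutator_split) (use xy in auto)
  then have "?f x \<otimes>\<^bsub>G Mod ?N\<^esub> ?f y = ?f ?c \<otimes>\<^bsub>G Mod ?N\<^esub> (?f y \<otimes>\<^bsub>G Mod ?N\<^esub> ?f x)"
    using xy c by (metis f.hom_mult m_closed)
  moreover have "?f x [^]\<^bsub>G Mod ?N\<^esub> m = \<one>\<^bsub>G Mod ?N\<^esub>" "?f y [^]\<^bsub>G Mod ?N\<^esub> n = \<one>\<^bsub>G Mod ?N\<^esub>"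
    using xy pow by (metis f.hom_nat_pow f.hom_one)+
  ultimately have "?f ?c = \<one>\<^bsub>G Mod ?N\<^esub>"
    using f.H.central_commutator_eq_one[of "?f x" "?f y" "?f ?c" m n] xy c central \<open>coprime m n\<close>
    by (metis f.hom_closed)
  then show ?case using ker c by blast
qed

lemma nilpotent_coprime_commute:
  fixes m n :: nat and G (structure)
  assumes "nilpotent_group G" "x \<in> carrier G" "y \<in> carrier G" "x [^] m = \<one>" "y [^] n = \<one>" "coprime m n"
  shows "x \<otimes> y = y \<otimes> x"
proof -
  interpret group G using assms by (simp add: nilpotent_group_def)
  obtain k where "lower_central G k = {\<one>}" using assms by (auto simp: nilpotent_group_def)
  then have "x \<otimes> y \<otimes> inv x \<otimes> inv y = \<one>"
    using coprime_commutator_in_lower_central[of x y m n k] assms by simp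
  then show ?thesis using commutator_split[of x y] assms(2,3) by simp
qed

section \<open>Non-cyclic subgroups\<close>

text \<open>The group generated by \<open>x\<close> is chosen largest among the cyclic subgroups of \<open>P\<close>, and \<open>y\<close> is
  chosen outside it, with the largest cyclic subgroup possible there. The product \<open>x y\<close> lies in
  neither of the two cyclic subgroups, because each contains exactly one of its factors. It
  generates neither factor, because \<open>x\<close> and \<open>y\<close> were chosen maximal.\<close>

lemma (in group) noncyclic_subgroup_antichain:
  assumes P: "subgroup P G" "finite P" and noncyclic: "\<And>x. x \<in> P \<Longrightarrow> generate G {x} \<noteq> P"
  obtains L where "L \<subseteq> P" "card L = 3" "power_antichain G L"
proof -
  define c where "c x = card (generate G {x})" for x
  have sub: "generate G {x} \<subseteq> P" if "x \<in> P" for x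
    using that P by (intro generate_subgroup_incl) auto
  have car: "x \<in> carrier G" if "x \<in> P" for x
    using subgroup.mem_carrier[OF P(1) that] .
  have self: "x \<in> generate G {x}" for x by (simp add: generate.incl)
  have less: "c x < c y" if "x \<in> generate G {y}" "y \<notin> generate G {x}" "y \<in> P" for x y
  proof -
    have "generate G {x} \<subseteq> generate G {y}"
      using generate_singleton_trans[OF _ that(1) car[OF that(3)]] by blast
    then have "generate G {x} \<subset> generate G {y}"
      using that(2) self[of y] by blast
    then show ?thesis unfolding c_def
      using sub[OF \<open>y \<in> P\<close>] \<open>finite P\<close> by (intro psubset_card_mono) (auto intro: finite_subset)
  qed
  have max: "\<exists>x\<in>S. \<forall>y\<in>S. c y \<le> c x" if "S \<subseteq> P" "S \<noteq> {}" for S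
  proof -
    have fin: "finite (c ` S)" using that \<open>finite P\<close> finite_subset by blast
    then have "Max (c ` S) \<in> c ` S" using that by (intro Max_in) auto
    then obtain x where "x \<in> S" "Max (c ` S) = c x" by blast
    with fin show ?thesis by (metis Max_ge imageI)
  qed
  obtain x where x: "x \<in> P" "\<forall>y\<in>P. c y \<le> c x"
    using max[of P] subgroup.one_closed[OF P(1)] by blast
  have "P - generate G {x} \<noteq> {}" using sub[OF x(1)] noncyclic[OF x(1)] by blast
  then obtain y where y: "y \<in> P" "y \<notin> generate G {x}"
    and y_max: "\<forall>z\<in>P - generate G {x}. c z \<le> c y"
    using max[of "P - generate G {x}"] by blast
  have xy: "x \<notin> generate G {y}" using less[of x y] x y by force
  let ?z = "x \<otimes> y"
  have zP: "?z \<in> P" using P x y by (simp add: subgroup.m_closed)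
  have grp: "subgroup (generate G {u}) G" if "u \<in> P" for u
    using car that by (intro generate_is_subgroup) simp
  have zx: "?z \<notin> generate G {x}"
  proof
    assume "?z \<in> generate G {x}"
    then have "inv x \<otimes> ?z \<in> generate G {x}"
      using grp[OF x(1)] self by (simp add: subgroup.m_closed subgroup.m_inv_closed)
    then show False using y x car by (simp flip: m_assoc)
  qed
  have zy: "?z \<notin> generate G {y}"
  proof
    assume "?z \<in> generate G {y}"
    then have "?z \<otimes> inv y \<in> generate G {y}"
      using grp[OF y(1)] self by (simp add: subgroup.m_closed subgroup.m_inv_closed)
    then show False using xy y x car by (simp add: m_assoc)
  qed
  have "x \<notin> generate G {?z}" using less[of x ?z] x zP zx by force
  moreover have "y \<notin> generate G {?z}" using less[of y ?z] y_max zP zx zy by force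
  ultimately have "card {x, y, ?z} = 3" "power_antichain G {x, y, ?z}"
    using power_antichain_triple xy y zx zy by metis+
  then show thesis using that[of "{x, y, ?z}"] x y zP by blast
qed

section \<open>Claws in nilpotent groups of composite order\<close>

lemma (in group) subgroup_pow_card_eq_one:
  assumes "subgroup H G" "x \<in> H"
  shows "x [^] card H = \<one>"
proof -
  interpret H: group "G\<lparr>carrier := H\<rparr>" using assms by (intro subgroup.subgroup_is_group) auto
  have "x [^]\<^bsub>G\<lparr>carrier := H\<rparr>\<^esub> card H = \<one>"
    using H.pow_order_eq_1[of x] assms by (simp add: order_def)
  then show ?thesis by (simp flip: nat_pow_consistent)
qed

lemma not_in_generate_of_coprime_pow:
  fixes m n :: nat and G (structure)
  assumes "group G" "u \<in> carrier G" "v \<in> carrier G" "u \<noteq> \<one>" "u [^] m = \<one>" "v [^] n = \<one>" "coprime m n"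
  shows "u \<notin> generate G {v}"
proof -
  interpret group G by fact
  show ?thesis using assms pow_eq_one_of_generate eq_one_of_coprime_pow by metis
qed

text \<open>An antichain \<open>L\<close> of three elements of \<open>P\<close> becomes, after multiplication by \<open>y\<close>, an antichain of
  three elements each having \<open>y\<close> as a power: a claw with centre \<open>y\<close>.\<close>

lemma claw_free_imp_coprime_subgroup_cyclic:
  fixes G (structure) and n :: nat
  assumes "finite (carrier G)" and nil: "nilpotent_group G"
    and cf: "claw_free (reduced_power_graph G)"
    and P: "subgroup P G" and y: "y \<in> carrier G" "y \<noteq> \<one>" "y [^] n = \<one>"
    and cop: "coprime (card P) n"
  shows "\<exists>x\<in>P. generate G {x} = P"
proof (rule ccontr)
  assume contra: "\<not> ?thesis"
  interpret group G using nil by (simp add: nilpotent_group_def)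
  have "finite P" using P assms(1) subgroup.subset finite_subset by blast
  then obtain L where L: "L \<subseteq> P" "card L = 3" "power_antichain G L"
    using noncyclic_subgroup_antichain[OF P] contra by metis
  have LP: "u \<in> carrier G" "u [^] card P = \<one>" if "u \<in> L" for u
    using that L(1) subgroup_pow_card_eq_one[OF P] subgroup.mem_carrier[OF P] by auto
  have comm: "u \<otimes> y = y \<otimes> u" if "u \<in> L" for u
    using nilpotent_coprime_commute[OF nil _ y(1) _ y(3) cop] LP that by blast
  let ?L = "(\<lambda>u. u \<otimes> y) ` L"
  have inj: "inj_on (\<lambda>u. u \<otimes> y) L" using LP y by (auto simp: inj_on_def)
  obtain e :: int where e: "(u \<otimes> y) [^] e = u" if "u \<in> L" for u
    using coprime_product_powers[OF cop] LP comm y by metis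
  have "u \<otimes> y \<notin> generate G {v \<otimes> y}" if uv: "u \<in> L" "v \<in> L" "u \<noteq> v" for u v
  proof
    assume "u \<otimes> y \<in> generate G {v \<otimes> y}"
    then obtain k :: int where k: "u \<otimes> y = (v \<otimes> y) [^] k"
      using generate_pow[of "v \<otimes> y"] LP uv y by auto
    have "u = ((v \<otimes> y) [^] k) [^] e" using e uv k by metis
    also have "\<dots> = ((v \<otimes> y) [^] e) [^] k"
      using LP uv y by (simp add: int_pow_pow mult.commute)
    also have "\<dots> = v [^] k" using e uv by simp
    finally have "u \<in> generate G {v}" using generate_pow LP uv by auto
    then show False using L uv by (auto simp: power_antichain_def pairwise_def)
  qed
  then have "power_antichain G ?L" by (auto simp: power_antichain_def pairwise_def)
  moreover have "card ?L = 3" using L inj by (simp add: card_image)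
  moreover have "?L \<subseteq> carrier G" using LP y by auto
  moreover have "\<forall>u\<in>?L. y \<in> generate G {u}"
    using coprime_factor_in_generate(2)[OF cop _ y(1) _ _ y(3)] LP comm by blast
  ultimately have "\<not> claw_free (reduced_power_graph G)"
    using not_claw_freeI[OF _ assms(1) y(1,2)] is_group by blast
  with cf show False by blast
qed

lemma (in group) cauchy_element:
  assumes "finite (carrier G)" "Factorial_Ring.prime (p::nat)" "p dvd order G"
  obtains x where "x \<in> carrier G" "x \<noteq> \<one>" "x [^] p = \<one>"
proof -
  obtain m where "order G = p ^ 1 * m" using assms by auto
  then obtain H where H: "subgroup H G" "card H = p"
    using sylow_thm[of p G 1 m] assms is_group by auto
  have "\<not> H \<subseteq> {\<one>}"
  proof
    assume "H \<subseteq> {\<one>}"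
    then have "card H \<le> card {\<one>}" by (intro card_mono) auto
    with H prime_gt_1_nat[OF assms(2)] show False by simp
  qed
  then obtain x where "x \<in> H" "x \<noteq> \<one>" by blast
  then show thesis using that H(2) subgroup_pow_card_eq_one[OF H(1)] subgroup.mem_carrier[OF H(1)] by metis
qed

text \<open>The centre of the claw is a product of three commuting elements of the three prime orders,
  and the leaves are these elements.\<close>

lemma three_primes_imp_not_claw_free:
  fixes G (structure) and p q r :: nat
  assumes "finite (carrier G)" and nil: "nilpotent_group G"
    and prime: "Factorial_Ring.prime p" "Factorial_Ring.prime q" "Factorial_Ring.prime r"
    and ne: "p \<noteq> q" "p \<noteq> r" "q \<noteq> r"
    and dvd: "p dvd order G" "q dvd order G" "r dvd order G"
  shows "\<not> claw_free (reduced_power_graph G)"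
proof -
  interpret group G using nil by (simp add: nilpotent_group_def)
  obtain x where x: "x \<in> carrier G" "x \<noteq> \<one>" "x [^] p = \<one>"
    using cauchy_element assms by metis
  obtain y where y: "y \<in> carrier G" "y \<noteq> \<one>" "y [^] q = \<one>"
    using cauchy_element assms by metis
  obtain z where z: "z \<in> carrier G" "z \<noteq> \<one>" "z [^] r = \<one>"
    using cauchy_element assms by metis
  have cop: "coprime p q" "coprime p r" "coprime q r" "coprime q p" "coprime r p" "coprime r q"
    using prime ne by (simp_all add: primes_coprime)
  have cop': "coprime (p * q) r" using cop by simp
  have xy: "x \<otimes> y = y \<otimes> x" using nilpotent_coprime_commute[OF nil x(1) y(1) x(3) y(3) cop(1)] .
  have xypow: "(x \<otimes> y) [^] (p * q) = \<one>"
  proof -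
    have "x [^] (p * q) = \<one>" using x by (simp flip: nat_pow_pow)
    moreover have "y [^] (p * q) = \<one>" using y by (simp add: mult.commute[of p] flip: nat_pow_pow)
    ultimately show ?thesis using x y xy by (simp add: pow_mult_distrib)
  qed
  let ?c = "(x \<otimes> y) \<otimes> z"
  have cz: "(x \<otimes> y) \<otimes> z = z \<otimes> (x \<otimes> y)"
    using nilpotent_coprime_commute[OF nil _ z(1) xypow z(3) cop'] x y by blast
  have car: "x \<otimes> y \<in> carrier G" "?c \<in> carrier G" using x y z by auto
  have zc: "z \<in> generate G {?c}" and "x \<otimes> y \<in> generate G {?c}"
    using coprime_factor_in_generate[OF cop' car(1) z(1) cz xypow z(3)] by auto
  then have "x \<in> generate G {?c}" "y \<in> generate G {?c}"
    using coprime_factor_in_generate[OF cop(1) x(1) y(1) xy x(3) y(3)] generate_singleton_trans car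
    by blast+
  with zc have "\<forall>u\<in>{x, y, z}. u \<in> generate G {?c}" by blast
  moreover have "?c \<noteq> \<one>"
    using pow_eq_one_of_generate[OF zc car(2), of 1] z by auto
  moreover have "card {x, y, z} = 3" "power_antichain G {x, y, z}"
    by (rule power_antichain_triple;
        rule not_in_generate_of_coprime_pow[OF is_group]; (rule x y z cop)+)+
  moreover have "{x, y, z} \<subseteq> carrier G" using x y z by auto
  ultimately show ?thesis using not_claw_freeI[OF is_group assms(1) car(2)] by metis
qed

text \<open>Every power of \<open>z = x\<^sup>p y\<^sup>q\<close> is killed by \<open>p\<^bsup>a-1\<^esup> q\<^bsup>b-1\<^esup>\<close>, but \<open>x\<close> is not; every power of
  \<open>x\<close> is killed by \<open>p\<^sup>a\<close>, but \<open>z\<close> is not: its factor \<open>y\<^sup>q\<close> has order \<open>q\<^bsup>b-1\<^esup>\<close>, which is divisible by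
  \<open>q\<close> as \<open>b \<ge> 2\<close>.\<close>

lemma (in group) prime_power_product_incomparable:
  fixes p q a b :: nat
  assumes car: "x \<in> carrier G" "y \<in> carrier G" and comm: "x \<otimes> y = y \<otimes> x"
    and ord: "ord x = p ^ a" "ord y = q ^ b" and ge: "2 \<le> a" "2 \<le> b"
    and prime: "Factorial_Ring.prime p" "Factorial_Ring.prime q" "p \<noteq> q"
  shows "x \<notin> generate G {x [^] p \<otimes> y [^] q}" "x [^] p \<otimes> y [^] q \<notin> generate G {x}"
proof -
  let ?z = "x [^] p \<otimes> y [^] q"
  have zpow: "?z [^] k = x [^] (p * k) \<otimes> y [^] (q * k)" for k :: nat
  proof -
    have "x [^] p \<otimes> y [^] q = y [^] q \<otimes> x [^] p"
      using car comm by (metis group_commutes_pow nat_pow_closed)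
    then have "?z [^] k = (x [^] p) [^] k \<otimes> (y [^] q) [^] k"
      by (rule pow_mult_distrib) (use car in auto)
    then show ?thesis using car by (simp add: nat_pow_pow)
  qed
  have zcar: "?z \<in> carrier G" using car by simp
  obtain p' q' where p': "p ^ a = p * p'" "p' = p ^ (a - 1)" and q': "q ^ b = q * q'" "q' = q ^ (b - 1)"
    using ge by (metis One_nat_def Suc_pred less_le_trans pos2 power_Suc)
  have ndvd: "\<not> p dvd q ^ k" "\<not> q dvd p ^ k" for k
    using prime primes_dvd_imp_eq prime_dvd_power by metis+
  show "x \<notin> generate G {?z}"
  proof
    assume "x \<in> generate G {?z}"
    moreover have "?z [^] (p' * q') = \<one>"
    proof -
      have "x [^] (p * (p' * q')) = \<one>" "y [^] (q * (p' * q')) = \<one>"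
        using car ord p' q' by (simp_all add: pow_eq_id)
      then show ?thesis using zpow by simp
    qed
    ultimately have "x [^] (p' * q') = \<one>" using zcar pow_eq_one_of_generate by blast
    \<comment> \<open>Cancelling the common factor \<open>p'\<close> leaves a power of \<open>q\<close> divisible by \<open>p\<close>.\<close>
    then have "p * p' dvd q' * p'" using car ord p' by (simp add: pow_eq_id mult.commute)
    then have "p dvd q'" using p' prime by (simp add: prime_gt_0_nat)
    then show False using ndvd q' by simp
  qed
  show "?z \<notin> generate G {x}"
  proof
    assume "?z \<in> generate G {x}"
    \<comment> \<open>The factor \<open>x\<^sup>p\<close> of \<open>z\<close> is killed by \<open>p\<^sup>a\<close> anyway, so \<open>y\<^sup>q\<close> has to be killed by \<open>p\<^sup>a\<close> as well.\<close>
    then have "?z [^] (p ^ a) = \<one>" using pow_eq_one_of_generate car ord by (metis pow_ord_eq_1)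
    moreover have "x [^] (p * p ^ a) = \<one>" using car ord by (simp add: pow_eq_id)
    ultimately have "y [^] (q * p ^ a) = \<one>" using zpow car by simp
    then have "q * q' dvd q * p ^ a" using car ord q' by (simp add: pow_eq_id)
    then have "q' dvd p ^ a" using prime by (simp add: prime_gt_0_nat)
    moreover have "q dvd q'" using ge q' by (simp add: dvd_power)
    ultimately show False using ndvd dvd_trans by blast
  qed
qed

text \<open>The centre is \<open>x y\<close>, and the leaves \<open>x\<close>, \<open>y\<close> and \<open>x\<^sup>p y\<^sup>q\<close> are powers of it.\<close>

lemma two_square_primes_imp_not_claw_free:
  fixes G (structure) and p q a b :: nat
  assumes "group G" "finite (carrier G)"
    and car: "x \<in> carrier G" "y \<in> carrier G" and comm: "x \<otimes> y = y \<otimes> x"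
    and ord: "group.ord G x = p ^ a" "group.ord G y = q ^ b" and ge: "2 \<le> a" "2 \<le> b"
    and prime: "Factorial_Ring.prime p" "Factorial_Ring.prime q" "p \<noteq> q"
  shows "\<not> claw_free (reduced_power_graph G)"
proof -
  interpret group G by fact
  let ?z = "x [^] p \<otimes> y [^] q" and ?c = "x \<otimes> y"
  have cop: "coprime (p ^ a) (q ^ b)" using prime by (simp add: primes_coprime)
  have pow: "x [^] (p ^ a) = \<one>" "y [^] (q ^ b) = \<one>" using car ord by (simp_all flip: ord)
  have gt: "1 < p ^ a" "1 < q ^ b" by (rule one_less_power; use prime ge in \<open>simp add: prime_gt_Suc_0_nat\<close>)+
  have ne: "x \<noteq> \<one>" "y \<noteq> \<one>" using gt ord by auto
  have swap: "?z = y [^] q \<otimes> x [^] p"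
    using car comm by (metis group_commutes_pow nat_pow_closed)
  have "x \<notin> generate G {?z}" "?z \<notin> generate G {x}"
    using prime_power_product_incomparable[OF car comm ord ge prime] by auto
  moreover have "y \<notin> generate G {?z}" "?z \<notin> generate G {y}"
    using prime_power_product_incomparable[OF car(2,1) comm[symmetric] ord(2,1) ge(2,1) prime(2,1)]
      prime(3) by (auto simp: swap)
  moreover have "x \<notin> generate G {y}"
    using not_in_generate_of_coprime_pow[OF is_group car ne(1) pow cop] .
  moreover have "y \<notin> generate G {x}"
    using not_in_generate_of_coprime_pow[OF is_group car(2,1) ne(2) pow(2,1)] cop
    by (simp add: coprime_commute)
  ultimately have L: "card {x, y, ?z} = 3" "power_antichain G {x, y, ?z}"
    using power_antichain_triple by metis+
  have gen: "x \<in> generate G {?c}" "y \<in> generate G {?c}"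
    using coprime_factor_in_generate[OF cop car comm pow] by auto
  have sub: "subgroup (generate G {?c}) G" using car by (intro generate_is_subgroup) simp
  have "x [^] p \<in> generate G {?c}" "y [^] q \<in> generate G {?c}"
    using gen sub by (metis int_pow_int subgroup_int_pow_closed)+
  then have "?z \<in> generate G {?c}" using sub by (simp add: subgroup.m_closed)
  with gen have "\<forall>u\<in>{x, y, ?z}. u \<in> generate G {?c}" by blast
  moreover have "?c \<noteq> \<one>"
    using pow_eq_one_of_generate[OF gen(1), of 1] car ne by auto
  ultimately show ?thesis
    using not_claw_freeI[OF is_group assms(2), of ?c "{x, y, ?z}"] car L by simp
qed

section \<open>Cyclicity and the order of the group\<close>

lemma two_prime_decomposition:
  fixes n :: nat
  assumes "n > 0" "\<nexists>p k. Factorial_Ring.prime p \<and> n = p ^ k"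
  obtains p q a b m where "Factorial_Ring.prime p" "Factorial_Ring.prime q" "p \<noteq> q" "1 \<le> a" "1 \<le> b"
    "n = p ^ a * q ^ b * m" "\<not> p dvd m" "\<not> q dvd m"
proof -
  have split: "\<exists>k j. 1 \<le> k \<and> m = r ^ k * j \<and> \<not> r dvd j"
    if rm: "Factorial_Ring.prime r" "r dvd m" "m > 0" for r m :: nat
  proof -
    obtain j where j: "m = r ^ multiplicity r m * j" "\<not> r dvd j"
      using multiplicity_decompose'[of m r] rm by (metis not_prime_unit not_gr_zero)
    moreover have "1 \<le> multiplicity r m"
      using rm j by (metis One_nat_def Suc_leI gr0I mult_1 power_0)
    ultimately show ?thesis by blast
  qed
  have "n \<noteq> 1" using assms(2) two_is_prime_nat power_0 by metis
  then obtain p where p: "Factorial_Ring.prime p" "p dvd n" using prime_factor_nat by blast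
  then obtain a j where a: "1 \<le> a" "n = p ^ a * j" "\<not> p dvd j" using split assms by blast
  have "j \<noteq> 1" using assms(2) a p by (metis mult_1_right)
  then obtain q where q: "Factorial_Ring.prime q" "q dvd j" using prime_factor_nat by blast
  have "j > 0" using a assms by (cases j) auto
  then obtain b m where b: "1 \<le> b" "j = q ^ b * m" "\<not> q dvd m" using split q by blast
  have "p \<noteq> q" using a q by blast
  moreover have "\<not> p dvd m" using a b by auto
  moreover have "n = p ^ a * q ^ b * m" using a b by simp
  ultimately show thesis using that p q a b by blast
qed

lemma (in group) cyclic_of_coprime_generators:
  assumes fin: "finite (carrier G)" and car: "x \<in> carrier G" "y \<in> carrier G"
    and comm: "x \<otimes> y = y \<otimes> x"
    and cop: "coprime (ord x) (ord y)" and ord: "order G = ord x * ord y"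
  shows "cyclic_group G"
proof -
  let ?c = "x \<otimes> y"
  have c: "?c \<in> carrier G" using car by simp
  have gen: "x \<in> generate G {?c}" "y \<in> generate G {?c}"
    using coprime_factor_in_generate[OF cop car comm] car by auto
  have "x [^] ord ?c = \<one>" "y [^] ord ?c = \<one>"
    using gen[THEN pow_eq_one_of_generate[OF _ c]] c by auto
  then have "order G dvd ord ?c" using car cop ord by (simp add: pow_eq_id divides_mult)
  then have "card (carrier G) \<le> card (generate G {?c})"
    using ord_ge_1[OF fin c] generate_pow_card[OF c] by (auto simp: order_def dest: dvd_imp_le)
  moreover have "generate G {?c} \<subseteq> carrier G" using c by (intro generate_incl) simp
  ultimately have "carrier G = generate G {?c}" using fin by (metis card_seteq)
  then have "carrier G = range (\<lambda>n::int. ?c [^] n)" using generate_pow[OF c] by auto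
  then show ?thesis using cyclic_group c by blast
qed

theorem proposition2p11:
  fixes G :: "('a, 'b) monoid_scheme"
  assumes "group G"
    and "finite (carrier G)"
    and "nilpotent_group G"
    and "claw_free (reduced_power_graph G)"
  shows "(\<exists>p. finite_p_group p G) \<or>
         (cyclic_group G \<and>
          (\<exists>p q n :: nat. Factorial_Ring.prime p \<and> Factorial_Ring.prime q \<and> p \<noteq> q \<and> 1 \<le> n \<and> order G = p ^ n * q))"
proof (cases "\<exists>p. finite_p_group p G")
  case False
  interpret group G by fact
  have "\<nexists>p k. Factorial_Ring.prime p \<and> order G = p ^ k"
    using False assms by (auto simp: finite_p_group_def)
  moreover have "order G > 0" using assms(2) order_gt_0_iff_finite by blast
  ultimately obtain p q a b m where prime: "Factorial_Ring.prime p" "Factorial_Ring.prime q" "p \<noteq> q"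
    and ge: "1 \<le> a" "1 \<le> b" and n: "order G = p ^ a * q ^ b * m" and ndvd: "\<not> p dvd m" "\<not> q dvd m"
    using two_prime_decomposition by metis
  have dvd: "p dvd order G" "q dvd order G" using n ge by (auto simp: dvd_power)
  have "m = 1"
  proof (rule ccontr)
    assume "m \<noteq> 1"
    then obtain r where r: "Factorial_Ring.prime r" "r dvd m" using prime_factor_nat by blast
    then have "p \<noteq> r" "q \<noteq> r" "r dvd order G" using ndvd n by auto
    then show False
      using three_primes_imp_not_claw_free[OF assms(2,3) prime(1,2) r(1)] prime(3) dvd assms(4) by blast
  qed
  then have n: "order G = p ^ a * q ^ b" using n by simp
  obtain P where P: "subgroup P G" "card P = p ^ a"
    using sylow_thm[OF prime(1) is_group n assms(2)] by blast
  obtain Q where Q: "subgroup Q G" "card Q = q ^ b"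
    using sylow_thm[OF prime(2) is_group _ assms(2), of b "p ^ a"] n by (auto simp: mult.commute)
  \<comment> \<open>An element of order \<open>q\<close> is the centre of the claw that forces \<open>P\<close> to be cyclic, and one of
    order \<open>p\<close> does the same for \<open>Q\<close>.\<close>
  obtain u where u: "u \<in> carrier G" "u \<noteq> \<one>\<^bsub>G\<^esub>" "u [^]\<^bsub>G\<^esub> p = \<one>\<^bsub>G\<^esub>"
    using cauchy_element[OF assms(2) prime(1) dvd(1)] .
  obtain v where v: "v \<in> carrier G" "v \<noteq> \<one>\<^bsub>G\<^esub>" "v [^]\<^bsub>G\<^esub> q = \<one>\<^bsub>G\<^esub>"
    using cauchy_element[OF assms(2) prime(2) dvd(2)] .
  have cop: "coprime p q" using prime by (simp add: primes_coprime)
  obtain x where x: "x \<in> P" "generate G {x} = P"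
    using claw_free_imp_coprime_subgroup_cyclic[OF assms(2-4) P(1) v] P cop by auto
  obtain y where y: "y \<in> Q" "generate G {y} = Q"
    using claw_free_imp_coprime_subgroup_cyclic[OF assms(2-4) Q(1) u] Q cop
    by (auto simp: coprime_commute)
  have car: "x \<in> carrier G" "y \<in> carrier G" using x y P Q subgroup.mem_carrier by metis+
  have ord: "ord x = p ^ a" "ord y = q ^ b"
    using generate_pow_card car x y P Q by simp_all
  have copord: "coprime (ord x) (ord y)" using cop ord by simp
  have comm: "x \<otimes>\<^bsub>G\<^esub> y = y \<otimes>\<^bsub>G\<^esub> x"
    using nilpotent_coprime_commute[OF assms(3) car _ _ copord] car by simp
  have "cyclic_group G"
    using cyclic_of_coprime_generators[OF assms(2) car comm copord] n ord by simp
  moreover have "a = 1 \<or> b = 1"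
    using two_square_primes_imp_not_claw_free[OF is_group assms(2) car comm ord _ _ prime] ge assms(4)
    by linarith
  then have "\<exists>p q n :: nat. Factorial_Ring.prime p \<and> Factorial_Ring.prime q \<and> p \<noteq> q \<and> 1 \<le> n \<and> order G = p ^ n * q"
  proof
    assume "b = 1"
    then show ?thesis using n prime ge by auto
  next
    assume "a = 1"
    then have "order G = q ^ b * p" using n by simp
    then show ?thesis using prime ge by metis
  qed
  ultimately show ?thesis by blast
qed blast

end
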